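(* For every $r \in \mathbb{N}$, $f(r) \geq r^2 + 3r - 1$. That is, no number smaller than $r^2+3r-1$ has the property that every strongly connected bridgeless mixed multigraph of radius $r$ admits an orientation of radius at most that number.
   Context: A mixed multigraph is a finite multigraph in which each edge may be either directed or undirected. A walk from $v_1$ to $v_k$ is a sequence of vertices $v_1,\dots,v_k$ such that for each $i \in \{1,\dots,k-1\}$ there is either an undirected edge $\{v_i,v_{i+1}\}$ or an edge directed from $v_i$ to $v_{i+1}$. A trail is a walk without repeated edges; a path is a trail without repeated vertices, except possibly $v_1=v_k$. The length of a path is its number of edges (directed and undirected). A mixed multigraph is strongly connected if there is a path from each vertex to every other vertex. A bridge in a strongly connected mixed multigraph is an undirected edge whose removal makes the graph no longer strongly connected; the graph is bridgeless if it has no bridge. An orientation of a mixed multigraph $G$ is an assignment of exactly one direction to each undirected edge of $G$ (directed edges keep their direction); the result is a directed multigraph. The distance $d_G(u,v)$ is the length of a shortest path from $u$ to $v$. The eccentricity of a vertex $u$ is $e(u)=\max\{\max_{v} d_G(u,v),\ \max_{v} d_G(v,u)\}$, and the radius of $G$ is $\min_{u\in V(G)} e(u)$ (infinite if $G$ is not strongly connected). These notions apply in particular to directed multigraphs. For $r\in\mathbb{N}$, $f(r)$ denotes the smallest number such that every strongly connected bridgeless mixed multigraph of radius $r$ has an orientation that is a strongly connected digraph of radius at most $f(r)$. *)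

theory Defs
  imports "HOL-Library.Uprod" "HOL-Library.Extended_Real"
begin

text \<open>
  Edges are abstract identifiers, so parallel edges are possible. An undirected edge has an
  unordered pair of end vertices. Loops of both kinds are permitted; they affect neither strong
  connectivity nor distances.
\<close>

datatype 'v edge_ends = Undirected "'v uprod" | Directed 'v 'v

fun end_vertices :: "'v edge_ends \<Rightarrow> 'v set" where
  "end_vertices (Undirected p) = set_uprod p"
| "end_vertices (Directed u v) = {u, v}"

record ('v, 'e) mixed_multigraph =
  verts :: "'v set"
  edges :: "'e set"
  ends :: "'e \<Rightarrow> 'v edge_ends"

definition mixed_multigraph :: "('v, 'e) mixed_multigraph \<Rightarrow> bool" where
  "mixed_multigraph G \<longleftrightarrow>
     finite (verts G) \<and> verts G \<noteq> {} \<and> finite (edges G) \<and>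
     (\<forall>e\<in>edges G. end_vertices (ends G e) \<subseteq> verts G)"

definition traverses :: "('v, 'e) mixed_multigraph \<Rightarrow> 'e \<Rightarrow> 'v \<Rightarrow> 'v \<Rightarrow> bool" where
  "traverses G e u v \<longleftrightarrow>
     e \<in> edges G \<and> (ends G e = Undirected (Upair u v) \<or> ends G e = Directed u v)"

text \<open>
  A walk is given by its vertex sequence together with the edges it uses, since in a multigraph
  the vertices alone do not determine the edges.
\<close>

definition walk :: "('v, 'e) mixed_multigraph \<Rightarrow> 'v list \<Rightarrow> 'e list \<Rightarrow> bool" where
  "walk G vs es \<longleftrightarrow>
     set vs \<subseteq> verts G \<and> length vs = Suc (length es) \<and>
     (\<forall>i<length es. traverses G (es ! i) (vs ! i) (vs ! Suc i))"

definition trail :: "('v, 'e) mixed_multigraph \<Rightarrow> 'v list \<Rightarrow> 'e list \<Rightarrow> bool" where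
  "trail G vs es \<longleftrightarrow> walk G vs es \<and> distinct es"

text \<open>
  The two distinctness conditions together say that only the first and the last vertex may
  coincide.
\<close>

definition path :: "('v, 'e) mixed_multigraph \<Rightarrow> 'v list \<Rightarrow> 'e list \<Rightarrow> bool" where
  "path G vs es \<longleftrightarrow> trail G vs es \<and> distinct (butlast vs) \<and> distinct (tl vs)"

definition path_from_to ::
    "('v, 'e) mixed_multigraph \<Rightarrow> 'v \<Rightarrow> 'v list \<Rightarrow> 'e list \<Rightarrow> 'v \<Rightarrow> bool" where
  "path_from_to G u vs es v \<longleftrightarrow> path G vs es \<and> hd vs = u \<and> last vs = v"

definition strongly_connected :: "('v, 'e) mixed_multigraph \<Rightarrow> bool" where
  "strongly_connected G \<longleftrightarrow>
     (\<forall>u\<in>verts G. \<forall>v\<in>verts G. u \<noteq> v \<longrightarrow> (\<exists>vs es. path_from_to G u vs es v))"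

definition remove_edge :: "('v, 'e) mixed_multigraph \<Rightarrow> 'e \<Rightarrow> ('v, 'e) mixed_multigraph" where
  "remove_edge G e = G\<lparr>edges := edges G - {e}\<rparr>"

definition bridge :: "('v, 'e) mixed_multigraph \<Rightarrow> 'e \<Rightarrow> bool" where
  "bridge G e \<longleftrightarrow>
     strongly_connected G \<and> e \<in> edges G \<and> (\<exists>p. ends G e = Undirected p) \<and>
     \<not> strongly_connected (remove_edge G e)"

definition bridgeless :: "('v, 'e) mixed_multigraph \<Rightarrow> bool" where
  "bridgeless G \<longleftrightarrow> (\<nexists>e. bridge G e)"

text \<open>
  An orientation is again a mixed multigraph, all of whose edges are directed, so connectivity,
  distance and radius apply to it unchanged.
\<close>

definition orientation_of ::
    "('v, 'e) mixed_multigraph \<Rightarrow> ('v, 'e) mixed_multigraph \<Rightarrow> bool" where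
  "orientation_of H G \<longleftrightarrow>
     verts H = verts G \<and> edges H = edges G \<and>
     (\<forall>e\<in>edges G. case ends G e of
         Directed u v \<Rightarrow> ends H e = Directed u v
       | Undirected p \<Rightarrow> \<exists>u v. p = Upair u v \<and> ends H e = Directed u v)"

text \<open>The infimum of the empty set is \<open>\<infinity>\<close>: unreachable vertices are at infinite distance.\<close>

definition distance :: "('v, 'e) mixed_multigraph \<Rightarrow> 'v \<Rightarrow> 'v \<Rightarrow> enat" where
  "distance G u v = Inf {enat (length es) | vs es. path_from_to G u vs es v}"

definition eccentricity :: "('v, 'e) mixed_multigraph \<Rightarrow> 'v \<Rightarrow> enat" where
  "eccentricity G u =
     max (Max ((\<lambda>v. distance G u v) ` verts G)) (Max ((\<lambda>v. distance G v u) ` verts G))"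

definition radius :: "('v, 'e) mixed_multigraph \<Rightarrow> enat" where
  "radius G = Min (eccentricity G ` verts G)"

text \<open>
  Every finite mixed multigraph is isomorphic to one whose vertices and edges are natural numbers,
  so quantifying over the latter loses no generality.
\<close>

definition radius_bound :: "nat \<Rightarrow> nat \<Rightarrow> bool" where
  "radius_bound r k \<longleftrightarrow>
     (\<forall>G :: (nat, nat) mixed_multigraph.
        mixed_multigraph G \<and> strongly_connected G \<and> bridgeless G \<and> radius G = enat r \<longrightarrow>
        (\<exists>H. orientation_of H G \<and> strongly_connected H \<and> radius H \<le> enat k))"

text \<open>The value is \<open>\<infinity>\<close> if no number is a bound for radius \<open>r\<close>.\<close>

definition f :: "nat \<Rightarrow> enat" where
  "f r = Inf {enat k | k. radius_bound r k}"

lemma le_f_iff: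
  fixes x :: real
  shows "ereal x \<le> ereal_of_enat (f r) \<longleftrightarrow> (\<forall>k. real k < x \<longrightarrow> \<not> radius_bound r k)"
proof (cases "\<exists>k. radius_bound r k")
  case False
  then have "f r = \<infinity>"
    by (simp add: f_def top_enat_def)
  with False show ?thesis by simp
next
  case True
  define m where "m = (LEAST k. radius_bound r k)"
  have m: "radius_bound r m" and least: "\<And>k. radius_bound r k \<Longrightarrow> m \<le> k"
    unfolding m_def using True by (auto intro: LeastI_ex Least_le)
  have "f r = enat m"
    unfolding f_def
  proof (rule antisym)
    show "Inf {enat k | k. radius_bound r k} \<le> enat m"
      using m by (auto intro: Inf_lower)
    show "enat m \<le> Inf {enat k | k. radius_bound r k}"
      using least by (auto intro: Inf_greatest)
  qed
  moreover have "x \<le> real m \<longleftrightarrow> (\<forall>k. real k < x \<longrightarrow> \<not> radius_bound r k)"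
  proof (intro iffI allI impI notI)
    fix k assume "x \<le> real m" "real k < x" "radius_bound r k"
    with least[of k] show False by simp
  next
    assume "\<forall>k. real k < x \<longrightarrow> \<not> radius_bound r k"
    with m show "x \<le> real m" by (meson not_le)
  qed
  ultimately show ?thesis by simp
qed

end

theory Submission
  imports Defs "HOL-Library.Countable" "HOL-Library.Numeral_Type"
begin

text \<open>
  The extremal graph of radius \<open>r\<close> is a tower of wheels. A wheel of size \<open>m\<close> around a hub is a
  closed rim made of three two-way paths of \<open>2m - 1\<close> vertices each (antiparallel directed edges)
  joined cyclically by single one-way edges; the middle vertex of each path is joined to the hub by
  an undirected spoke. All rim vertices are within distance \<open>m\<close> of the hub in both directions. In a
  strong orientation neither all spokes point outward nor all inward. Around the rim, an outward
  spoke followed by an inward one puts the end of the latter at distance at least \<open>2m\<close> from the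
  hub, and likewise gives a vertex from which the hub is at distance at least \<open>2m\<close>. Moreover two of
  the three spokes point the same way, and this raises one of the two distances to \<open>4m - 1\<close>.

  Start with a wheel of size \<open>r\<close> and attach to the ends of its spokes wheels of size \<open>r - 1\<close>, to
  the ends of their spokes wheels of size \<open>r - 2\<close>, and so on down to \<open>1\<close>. Every hub is a cut
  vertex, so in an oriented tower distances along a suitable branch add up to at least
  \<open>(4r - 1) + 2(r - 1) + \<dots> + 2 = r\<^sup>2 + 3r - 1\<close>, always from the root or always towards the root.
  Using two wheels at every hub makes this a lower bound for the eccentricity of every vertex.
\<close>

subsection \<open>Distances via walks and potentials\<close>

definition steps :: "('v, 'e) mixed_multigraph \<Rightarrow> 'v rel" where
  "steps G = {(u, v). u \<in> verts G \<and> v \<in> verts G \<and> (\<exists>e. traverses G e u v)}"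

text \<open>In a shortest step sequence a repeated vertex could be cut out, so none occurs; then no
  edge repeats either, and the sequence is a path.\<close>

lemma path_from_to_if_relpow:
  assumes "(u, v) \<in> steps G ^^ n" and "u \<in> verts G"
  shows "\<exists>vs es. path_from_to G u vs es v \<and> length es \<le> n"
proof -
  define k where "k = (LEAST k. (u, v) \<in> steps G ^^ k)"
  have k: "(u, v) \<in> steps G ^^ k" and le: "k \<le> n"
    using assms unfolding k_def by (auto intro: LeastI Least_le)
  have least: "k \<le> l" if "(u, v) \<in> steps G ^^ l" for l
    using that unfolding k_def by (rule Least_le)
  from k obtain w where w: "w 0 = u" "w k = v" "\<And>i. i < k \<Longrightarrow> (w i, w (Suc i)) \<in> steps G"
    by (auto simp: relpow_fun_conv)
  define c where "c i = (SOME e. traverses G e (w i) (w (Suc i)))" for i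
  have c: "traverses G (c i) (w i) (w (Suc i))" if "i < k" for i
    using w(3)[OF that] unfolding c_def steps_def by (auto intro: someI_ex)
  have verts: "w i \<in> verts G" if "i \<le> k" for i
    using that w(1) w(3)[of "i - 1"] assms(2) by (cases i) (auto simp: steps_def)
  have neq: "w i \<noteq> w j" if "i < j" "j \<le> k" for i j
  proof
    assume eq: "w i = w j"
    have "(u, w i) \<in> steps G ^^ i"
      unfolding relpow_fun_conv using w that by (intro exI[of _ w]) auto
    moreover have "(w j, v) \<in> steps G ^^ (k - j)"
      unfolding relpow_fun_conv using w that by (intro exI[of _ "\<lambda>l. w (j + l)"]) auto
    ultimately have "(u, v) \<in> steps G ^^ (i + (k - j))"
      by (auto simp: relpow_add eq)
    from least[OF this] that show False by simp
  qed
  then have inj: "inj_on w {0..<Suc k}"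
    by (intro linorder_inj_onI) auto
  \<comment> \<open>An edge shared by the steps at \<open>i\<close> and \<open>j\<close> would make
    \<open>w i\<close> equal to \<open>w j\<close> or \<open>w (Suc j)\<close>, whichever way it is
    traversed.\<close>
  have "inj_on c {0..<k}"
  proof (intro linorder_inj_onI)
    fix i j assume ij: "i < j" "i \<in> {0..<k}" "j \<in> {0..<k}"
    with c[of i] c[of j] neq[of i j] neq[of i "Suc j"] show "c i \<noteq> c j"
      by (auto simp: traverses_def)
  qed auto
  moreover have "inj_on w {0..<k}" "inj_on w {Suc 0..<Suc k}"
    by (rule inj_on_subset[OF inj]; auto)+
  moreover have "butlast (map w [0..<Suc k]) = map w [0..<k]"
    "tl (map w [0..<Suc k]) = map w [Suc 0..<Suc k]"
    by simp (simp add: map_tl[symmetric] del: upt_Suc)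
  moreover have "hd (map w [0..<Suc k]) = u" "last (map w [0..<Suc k]) = v"
    using w(1,2) by (simp_all add: hd_map del: upt_Suc) (simp add: last_map)
  moreover have "walk G (map w [0..<Suc k]) (map c [0..<k])"
    using c verts by (auto simp: walk_def simp del: upt_Suc)
  ultimately have "path_from_to G u (map w [0..<Suc k]) (map c [0..<k]) v"
    unfolding path_from_to_def path_def trail_def
    by (simp add: distinct_map del: upt_Suc)
  with le show ?thesis by force
qed

lemma distance_le_if_relpow:
  assumes "(u, v) \<in> steps G ^^ n" and "u \<in> verts G"
  shows "distance G u v \<le> enat n"
proof -
  from path_from_to_if_relpow[OF assms] obtain vs es
    where p: "path_from_to G u vs es v" and le: "length es \<le> n" by blast
  from p have "distance G u v \<le> enat (length es)"
    unfolding distance_def by (intro Inf_lower) auto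
  also have "\<dots> \<le> enat n" using le by simp
  finally show ?thesis .
qed

lemma strongly_connected_if_rtrancl:
  assumes "\<And>u v. u \<in> verts G \<Longrightarrow> v \<in> verts G \<Longrightarrow> (u, v) \<in> (steps G)\<^sup>*"
  shows "strongly_connected G"
  unfolding strongly_connected_def
proof (intro ballI impI)
  fix u v assume "u \<in> verts G" "v \<in> verts G"
  with assms[of u v] obtain n where "(u, v) \<in> steps G ^^ n"
    by (auto dest: rtrancl_imp_relpow)
  from path_from_to_if_relpow[OF this \<open>u \<in> verts G\<close>]
  show "\<exists>vs es. path_from_to G u vs es v" by blast
qed

lemma potential_le_path_length:
  fixes \<phi> :: "'v \<Rightarrow> int"
  assumes "\<And>e y z. traverses G e y z \<Longrightarrow> \<phi> z \<le> \<phi> y + 1"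
    and "path_from_to G u vs es v"
  shows "\<phi> v \<le> \<phi> u + int (length es)"
proof -
  from assms(2) have len: "length vs = Suc (length es)" and hd: "hd vs = u" and last: "last vs = v"
    and tr: "\<And>i. i < length es \<Longrightarrow> traverses G (es ! i) (vs ! i) (vs ! Suc i)"
    by (auto simp: path_from_to_def path_def trail_def walk_def)
  have "\<phi> (vs ! i) \<le> \<phi> (vs ! 0) + int i" if "i \<le> length es" for i
    using that
  proof (induction i)
    case (Suc i)
    with assms(1)[OF tr[of i]] show ?case by simp
  qed simp
  moreover have "vs ! 0 = u" "vs ! length es = v"
    using hd last len hd_conv_nth[of vs] last_conv_nth[of vs] by (cases "vs = []"; simp)+
  ultimately show ?thesis by auto
qed

text \<open>All lower bounds on distances below rest on such a potential, which bounds every path at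
  once and also covers unreachable vertices.\<close>

lemma distance_ge_if_potential:
  fixes \<phi> :: "'v \<Rightarrow> int"
  assumes "\<And>e y z. traverses G e y z \<Longrightarrow> \<phi> z \<le> \<phi> y + 1" and "\<phi> u + int n \<le> \<phi> v"
  shows "enat n \<le> distance G u v"
  unfolding distance_def
proof (intro Inf_greatest, safe)
  fix vs es assume "path_from_to G u vs es v"
  with assms(1) have "\<phi> v \<le> \<phi> u + int (length es)"
    by (rule potential_le_path_length)
  with assms(2) show "enat n \<le> enat (length es)" by simp
qed

section \<open>Eccentricity and radius through inequalities\<close>

lemma eccentricity_le_iff:
  assumes "finite (verts G)" and "verts G \<noteq> {}"
  shows "eccentricity G u \<le> k \<longleftrightarrow>
    (\<forall>v\<in>verts G. distance G u v \<le> k \<and> distance G v u \<le> k)"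
  using assms by (auto simp: eccentricity_def)

lemma distance_le_eccentricity:
  assumes "finite (verts G)" and "v \<in> verts G"
  shows "distance G u v \<le> eccentricity G u" and "distance G v u \<le> eccentricity G u"
  using assms eccentricity_le_iff[of G u "eccentricity G u"] by blast+

lemma le_radius_iff:
  assumes "finite (verts G)" and "verts G \<noteq> {}"
  shows "k \<le> radius G \<longleftrightarrow> (\<forall>u\<in>verts G. k \<le> eccentricity G u)"
  using assms by (auto simp: radius_def)

subsection \<open>A single wheel\<close>

text \<open>Arithmetic in type \<open>3\<close> closes the three paths to a cycle, and offsets
  centred at 0 let negation of both coordinates reverse every arc.\<close>

definition rim :: "int \<Rightarrow> 3 \<times> int \<Rightarrow> 3 \<times> int \<Rightarrow> bool" where
  "rim m = (\<lambda>(q, p) (q', p'). \<bar>p\<bar> < m \<and> \<bar>p'\<bar> < m \<and>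
     (q' = q \<and> \<bar>p' - p\<bar> = 1 \<or> q' = q + 1 \<and> p = m - 1 \<and> p' = 1 - m))"

lemma Z3_cases: "(q :: 3) = a \<or> q = a + 1 \<or> q = a + 2"
proof -
  have "d = 0 \<or> d = 1 \<or> d = 2" for d :: 3
  proof (induct d)
    case (of_int z)
    then have "z = 0 \<or> z = 1 \<or> z = 2" by auto
    then show ?case by auto
  qed
  from this[of "q - a"] show ?thesis by (auto simp: algebra_simps)
qed

lemma Z3_neq [simp]:
  "(q :: 3) + 1 \<noteq> q" "q + 2 \<noteq> q" "q + 1 \<noteq> q + 2" "q + 2 \<noteq> q + 1"
  "q \<noteq> q + 1" "q \<noteq> q + 2"
  by auto

lemma Z3_add [simp]: "(q :: 3) + 2 + 1 = q" "(q :: 3) + 1 + 1 = q + 2"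
  by (simp_all add: add.assoc)

lemma rim_reflect: "rim m (q, p) (q', p') \<longleftrightarrow> rim m (- q', - p') (- q, - p)"
  unfolding rim_def by (auto simp: algebra_simps abs_minus_commute)

text \<open>
  Here \<open>\<sigma> q\<close> says whether the spoke at path \<open>q\<close> points away from the hub, whose potential is 0. The
  flag \<open>d\<close> selects the direction: potentials for \<open>d = True\<close> bound distances from the hub, those for
  \<open>d = False\<close> distances to it.
\<close>

definition wheel_potential ::
    "bool \<Rightarrow> int \<Rightarrow> (3 \<Rightarrow> bool) \<Rightarrow> int \<Rightarrow> (3 \<times> int \<Rightarrow> int) \<Rightarrow> bool" where
  "wheel_potential d m \<sigma> n g \<longleftrightarrow>
     (\<forall>i j. (if d then rim m i j else rim m j i) \<longrightarrow> g j \<le> g i + 1) \<and>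
     (\<forall>q. 0 \<le> g (q, 0)) \<and> (\<forall>q. \<sigma> q = d \<longrightarrow> g (q, 0) \<le> 1) \<and> (\<exists>q. n \<le> g (q, 0))"

text \<open>Negating both coordinates reverses the rim, and reversal exchanges outward and inward
  spokes. Hence only \<open>d = True\<close> needs an explicit potential.\<close>

lemma wheel_potential_reflect:
  assumes "wheel_potential True m (\<lambda>q. \<not> \<sigma> (- q)) n g"
  shows "wheel_potential False m \<sigma> n (\<lambda>(q, p). g (- q, - p))"
proof -
  from assms have *: "\<And>i j. rim m i j \<Longrightarrow> g j \<le> g i + 1" "\<And>q. 0 \<le> g (q, 0)"
    "\<And>q. \<not> \<sigma> (- q) \<Longrightarrow> g (q, 0) \<le> 1" "\<exists>q. n \<le> g (q, 0)"
    by (auto simp: wheel_potential_def)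
  from *(4) have "\<exists>q. n \<le> g (- q, 0)"
    by (metis minus_minus)
  moreover have "\<not> \<sigma> q \<Longrightarrow> g (- q, 0) \<le> 1" for q
    using *(3)[of "- q"] by simp
  moreover have "g (- q', - p') \<le> g (- q, - p) + 1" if "rim m (q', p') (q, p)" for q p q' p'
    using *(1) that rim_reflect by blast
  ultimately show ?thesis
    using *(2) unfolding wheel_potential_def by simp
qed

text \<open>
  The distance travelled along the rim starting with the outward spoke at \<open>a\<close>. It is cut off to 0
  before the next one-way edge, so that it does not exceed 1 at outward spokes beyond.
\<close>

definition arc_potential :: "int \<Rightarrow> bool \<Rightarrow> 3 \<Rightarrow> 3 \<times> int \<Rightarrow> int" where
  "arc_potential m w a = (\<lambda>(q, p). if q = a then max 0 (p + 1)
     else if q = a + 1 then 2 * m + p else if w then 4 * m - 1 + p else 0)"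

text \<open>The constants make the value rise by exactly 1 across the one-way edge from
  \<open>a\<close> to \<open>a + 1\<close> and, if \<open>w\<close> holds, across the next one. On
  returning to \<open>a\<close> the value is at most 1, by the cut-off.\<close>

lemma arc_potential_rim:
  assumes "rim m i j"
  shows "arc_potential m w a j \<le> arc_potential m w a i + 1"
proof -
  obtain q p q' p' where ij: "i = (q, p)" "j = (q', p')" by fastforce
  from assms consider "q' = q" "p' \<le> p + 1" "\<bar>p\<bar> < m" "\<bar>p'\<bar> < m"
    | "q' = q + 1" "p = m - 1" "p' = 1 - m" "0 < m"
    by (auto simp: ij rim_def)
  then show ?thesis
  proof cases
    case 1
    then show ?thesis by (auto simp: ij arc_potential_def max_def)
  next
    case 2
    with Z3_cases[of q a] show ?thesis by (elim disjE) (simp_all add: ij arc_potential_def)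
  qed
qed

text \<open>At the three spoke ends the values are 1, \<open>2 * m\<close>, and
  \<open>4 * m - 1\<close> or 0; those above 1 belong to inward spokes.\<close>

lemma wheel_potential_True:
  assumes "1 \<le> m" and "\<sigma> a" and "\<not> \<sigma> (a + 1)" and "w \<Longrightarrow> \<not> \<sigma> (a + 2)"
  shows "wheel_potential True m \<sigma> (if w then 4 * m - 1 else 2 * m) (arc_potential m w a)"
  unfolding wheel_potential_def
proof (intro conjI allI impI)
  show "\<exists>q. (if w then 4 * m - 1 else 2 * m) \<le> arc_potential m w a (q, 0)"
    by (rule exI[of _ "if w then a + 2 else a + 1"]) (simp add: arc_potential_def)
  fix q
  show "0 \<le> arc_potential m w a (q, 0)"
    using assms(1) by (simp add: arc_potential_def)
  assume "\<sigma> q = True"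
  with Z3_cases[of q a] assms show "arc_potential m w a (q, 0) \<le> 1"
    by (auto simp: arc_potential_def)
qed (simp add: arc_potential_rim)

lemma nonconst_Z3:
  assumes "\<sigma> (a :: 3)" and "\<not> \<sigma> b"
  obtains q where "\<sigma> q" "\<not> \<sigma> (q + 1)" 
  using Z3_cases[of b a] assms by (metis Z3_add(2))

lemma ex_wheel_potential:
  assumes "1 \<le> m" and "\<sigma> a" and "\<not> \<sigma> b"
  shows "\<exists>g. wheel_potential d m \<sigma> (2 * m) g"
proof (cases d)
  case True
  from assms(2,3) obtain q where "\<sigma> q" "\<not> \<sigma> (q + 1)" by (rule nonconst_Z3)
  with wheel_potential_True[of m \<sigma> q False] assms(1) True show ?thesis by auto
next
  case False
  let ?\<sigma> = "\<lambda>q. \<not> \<sigma> (- q)"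
  have "?\<sigma> (- b)" "\<not> ?\<sigma> (- a)" using assms by auto
  then obtain q where "?\<sigma> q" "\<not> ?\<sigma> (q + 1)" by (rule nonconst_Z3)
  with wheel_potential_True[of m ?\<sigma> q False] assms(1) False show ?thesis
    by (auto dest: wheel_potential_reflect)
qed

text \<open>After an outward spoke at \<open>q\<close> and an inward one at \<open>q + 1\<close>,
  the third spoke decides: if it is inward, the distance from the hub is long; if outward, the
  distance to it.\<close>

lemma ex_long_wheel_potential:
  assumes "1 \<le> m" and "\<sigma> a" and "\<not> \<sigma> b"
  shows "\<exists>d g. wheel_potential d m \<sigma> (4 * m - 1) g"
proof -
  from assms(2,3) obtain q where q: "\<sigma> q" "\<not> \<sigma> (q + 1)" by (rule nonconst_Z3)
  show ?thesis
  proof (cases "\<sigma> (q + 2)")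
    case False
    with wheel_potential_True[of m \<sigma> q True] assms(1) q show ?thesis by auto
  next
    case True
    let ?\<sigma> = "\<lambda>q. \<not> \<sigma> (- q)"
    \<comment> \<open>Read backwards, the rim starts at the inward spoke \<open>q + 1\<close> and
      continues with \<open>q\<close> and then \<open>q - 1\<close>, which is
      \<open>q + 2\<close>.\<close>
    have "- (- (q + 1) + 1) = q" "- (- (q + 1) + 2) = q + 2"
      using Z3_add(1)[of q] by (simp_all add: algebra_simps)
    then have "?\<sigma> (- (q + 1))" "\<not> ?\<sigma> (- (q + 1) + 1)" "\<not> ?\<sigma> (- (q + 1) + 2)"
      using q True by (simp_all only: minus_minus not_not not_False_eq_True)
    from wheel_potential_True[OF assms(1) this, of True]
    have "wheel_potential True m ?\<sigma> (4 * m - 1) (arc_potential m True (- (q + 1)))" by simp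
    then show ?thesis by (blast dest: wheel_potential_reflect)
  qed
qed

section \<open>Strong connectivity of the rim\<close>

lemma rim_connected:
  assumes "\<bar>p\<bar> < m" and "\<bar>p'\<bar> < m"
  shows "(rim m)\<^sup>*\<^sup>* (q, p) (q', p')"
proof -
  have up: "(rim m)\<^sup>*\<^sup>* (q, p) (q, p + int k)" if "\<bar>p\<bar> < m" "\<bar>p + int k\<bar> < m" for q p k
    using that(2)
  proof (induction k)
    case (Suc k)
    from that(1) Suc.prems have "\<bar>p + int k\<bar> < m" by auto
    moreover from this Suc.prems have "rim m (q, p + int k) (q, p + int (Suc k))"
      by (simp add: rim_def)
    ultimately show ?case
      using Suc.IH by (meson rtranclp.rtrancl_into_rtrancl)
  qed simp
  have down: "(rim m)\<^sup>*\<^sup>* (q, p) (q, p - int k)" if "\<bar>p\<bar> < m" "\<bar>p - int k\<bar> < m" for q p k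
    using that(2)
  proof (induction k)
    case (Suc k)
    from that(1) Suc.prems have "\<bar>p - int k\<bar> < m" by auto
    moreover from this Suc.prems have "rim m (q, p - int k) (q, p - int (Suc k))"
      by (simp add: rim_def)
    ultimately show ?case
      using Suc.IH by (meson rtranclp.rtrancl_into_rtrancl)
  qed simp
  have same: "(rim m)\<^sup>*\<^sup>* (q, p) (q, p')" if "\<bar>p\<bar> < m" "\<bar>p'\<bar> < m" for q p p'
    using up[of p "nat (p' - p)" q] down[of p "nat (p - p')" q] that
    by (cases "p \<le> p'") auto
  have nxt: "(rim m)\<^sup>*\<^sup>* (q, p) (q + 1, p')" if "\<bar>p\<bar> < m" "\<bar>p'\<bar> < m" for q p p'
  proof -
    have "(rim m)\<^sup>*\<^sup>* (q, p) (q, m - 1)" "(rim m)\<^sup>*\<^sup>* (q + 1, 1 - m) (q + 1, p')"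
      using that by (auto intro!: same)
    moreover have "rim m (q, m - 1) (q + 1, 1 - m)"
      using that by (auto simp: rim_def)
    ultimately show ?thesis
      by (meson rtranclp.rtrancl_into_rtrancl rtranclp_trans)
  qed
  have "(rim m)\<^sup>*\<^sup>* (q, p) (q + 2, p')"
    using nxt[OF assms(1,1), of q] nxt[OF assms, of "q + 1"] by simp
  with Z3_cases[of q' q] same[OF assms] nxt[OF assms] show ?thesis by auto
qed

subsection \<open>The tower of wheels\<close>

text \<open>
  A vertex lists the positions on the successive wheels, innermost first, so the root is the empty
  list. A position consists of one of the two wheels at a hub, one of the three paths of its rim,
  and a signed offset from the middle of that path; hence the spoke ends are at offset 0.
\<close>

type_synonym vertex = "(bool \<times> 3 \<times> int) list"

definition hub :: "nat \<Rightarrow> vertex \<Rightarrow> bool" where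
  "hub r x \<longleftrightarrow> length x < r \<and> (\<forall>(b, q, p)\<in>set x. p = 0)"

abbreviation wheel_size :: "nat \<Rightarrow> vertex \<Rightarrow> int" where
  "wheel_size r x \<equiv> int r - int (length x)"

definition tower_verts :: "nat \<Rightarrow> vertex set" where
  "tower_verts r = insert [] {(b, q, p) # x | b q p x. hub r x \<and> \<bar>p\<bar> < wheel_size r x}"

definition rim_arcs :: "nat \<Rightarrow> (vertex \<times> vertex) set" where
  "rim_arcs r = {((b, i) # x, (b, j) # x) | b i j x. hub r x \<and> rim (wheel_size r x) i j}"

definition spokes :: "nat \<Rightarrow> (vertex \<times> vertex) set" where
  "spokes r = {((b, q, 0) # x, x) | b q x. hub r x}"

text \<open>Coding by \<open>to_nat\<close> yields a graph on natural numbers, as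
  \<open>radius_bound\<close> demands. An edge is the code of its pair of ends, for a spoke with the
  outer end first.\<close>

definition tower :: "nat \<Rightarrow> (nat, nat) mixed_multigraph" where
  "tower r = \<lparr>verts = to_nat ` tower_verts r, edges = to_nat ` (rim_arcs r \<union> spokes r),
     ends = (\<lambda>e. case from_nat e of (y, z) \<Rightarrow>
       if (y, z) \<in> spokes r then Undirected (Upair (to_nat y) (to_nat z))
       else Directed (to_nat y) (to_nat z))\<rparr>"

lemma hub_tower_verts: "hub r x \<Longrightarrow> x \<in> tower_verts r"
  by (cases x) (auto simp: hub_def tower_verts_def)

lemma arcs_subset_verts: "rim_arcs r \<union> spokes r \<subseteq> tower_verts r \<times> tower_verts r"
  by (auto simp: rim_arcs_def spokes_def hub_tower_verts)
    (auto simp: tower_verts_def rim_def hub_def split: prod.splits)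

lemma finite_tower_verts: "finite (tower_verts r)"
proof (rule finite_subset)
  let ?A = "(UNIV :: bool set) \<times> (UNIV :: 3 set) \<times> {- int r..int r}"
  show "tower_verts r \<subseteq> {x. set x \<subseteq> ?A \<and> length x \<le> r}"
  proof
    fix y assume "y \<in> tower_verts r"
    then consider "y = []"
      | b q p x where "y = (b, q, p) # x" "hub r x" "\<bar>p\<bar> < wheel_size r x"
      by (auto simp: tower_verts_def)
    then show "y \<in> {x. set x \<subseteq> ?A \<and> length x \<le> r}"
    proof cases
      case 2
      then have "set x \<subseteq> ?A" by (auto simp: hub_def)
      with 2 show ?thesis by (auto simp: hub_def)
    qed simp
  qed
  show "finite {x. set x \<subseteq> ?A \<and> length x \<le> r}"
    by (intro finite_lists_length_le) simp
qed

lemma rim_arcs_spokes_disjoint: "rim_arcs r \<inter> spokes r = {}"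
  by (auto simp: rim_arcs_def spokes_def)

lemma verts_tower [simp]: "verts (tower r) = to_nat ` tower_verts r"
  by (simp add: tower_def)

lemma edges_tower [simp]: "edges (tower r) = to_nat ` (rim_arcs r \<union> spokes r)"
  by (simp add: tower_def)

lemma ends_rim_arc:
  "(y, z) \<in> rim_arcs r \<Longrightarrow> ends (tower r) (to_nat (y, z)) = Directed (to_nat y) (to_nat z)"
  using rim_arcs_spokes_disjoint[of r] by (auto simp: tower_def)

lemma ends_spoke:
  "(y, z) \<in> spokes r \<Longrightarrow>
     ends (tower r) (to_nat (y, z)) = Undirected (Upair (to_nat y) (to_nat z))"
  by (simp add: tower_def)

lemma mixed_multigraph_tower: "mixed_multigraph (tower r)"
proof -
  have "finite (rim_arcs r \<union> spokes r)"
    by (rule finite_subset[OF arcs_subset_verts]) (simp add: finite_tower_verts)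
  then have "finite (edges (tower r))" "finite (verts (tower r))" "verts (tower r) \<noteq> {}"
    by (simp_all add: finite_tower_verts) (simp add: tower_verts_def)
  moreover have "end_vertices (ends (tower r) e) \<subseteq> verts (tower r)" if e: "e \<in> edges (tower r)" for e
  proof -
    from e obtain y z where yz: "e = to_nat (y, z)" "(y, z) \<in> rim_arcs r \<union> spokes r"
      by auto
    with arcs_subset_verts have "y \<in> tower_verts r" "z \<in> tower_verts r" by blast+
    with yz show ?thesis by (auto simp: ends_rim_arc ends_spoke)
  qed
  ultimately show ?thesis by (simp add: mixed_multigraph_def)
qed

lemma traverses_tower:
  "traverses (tower r) e u v \<longleftrightarrow>
     (\<exists>y z. e = to_nat (y, z) \<and>
        ((y, z) \<in> rim_arcs r \<and> u = to_nat y \<and> v = to_nat z \<or>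
         (y, z) \<in> spokes r \<and> (u = to_nat y \<and> v = to_nat z \<or> u = to_nat z \<and> v = to_nat y)))"
proof -
  have "traverses (tower r) e u v \<longleftrightarrow>
    (\<exists>y z. e = to_nat (y, z) \<and> (y, z) \<in> rim_arcs r \<union> spokes r \<and>
       (ends (tower r) e = Undirected (Upair u v) \<or> ends (tower r) e = Directed u v))"
    by (auto simp: traverses_def)
  also have "\<dots> \<longleftrightarrow> (\<exists>y z. e = to_nat (y, z) \<and>
        ((y, z) \<in> rim_arcs r \<and> u = to_nat y \<and> v = to_nat z \<or>
         (y, z) \<in> spokes r \<and> (u = to_nat y \<and> v = to_nat z \<or> u = to_nat z \<and> v = to_nat y)))"
    by (intro ex_cong1 conj_cong refl) (auto simp: ends_rim_arc ends_spoke)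
  finally show ?thesis .
qed

section \<open>Potentials on an oriented tower\<close>

text \<open>Hubs are cut vertices, so distances from or to the root add up over the wheels passed;
  \<open>g x\<close> is the contribution of the wheels at hub \<open>x\<close>.\<close>

fun pot :: "(vertex \<Rightarrow> bool \<times> 3 \<times> int \<Rightarrow> int) \<Rightarrow> vertex \<Rightarrow> int" where
  "pot g [] = 0"
| "pot g (i # x) = pot g x + g x i"

definition outward :: "(nat, nat) mixed_multigraph \<Rightarrow> bool \<Rightarrow> vertex \<Rightarrow> 3 \<Rightarrow> bool" where
  "outward H b x q \<longleftrightarrow>
     ends H (to_nat ((b, q, 0 :: int) # x, x)) = Directed (to_nat x) (to_nat ((b, q, 0 :: int) # x))"

text \<open>These are the local conditions under which \<open>pot g\<close>, or
  \<open>- pot g\<close> if \<open>d\<close> is false, rises by at most 1 along every oriented edge.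
  They can be met hub by hub, but with one common \<open>d\<close>.\<close>

definition admissible ::
    "nat \<Rightarrow> (nat, nat) mixed_multigraph \<Rightarrow> bool \<Rightarrow> (vertex \<Rightarrow> bool \<times> 3 \<times> int \<Rightarrow> int) \<Rightarrow> bool" where
  "admissible r H d g \<longleftrightarrow>
     (\<forall>x b. hub r x \<longrightarrow>
        (\<forall>i j. (if d then rim (wheel_size r x) i j else rim (wheel_size r x) j i) \<longrightarrow>
           g x (b, j) \<le> g x (b, i) + 1) \<and>
        (\<forall>q. 0 \<le> g x (b, q, 0)) \<and> (\<forall>q. outward H b x q = d \<longrightarrow> g x (b, q, 0) \<le> 1))"

lemma traverses_orientation_cases:
  assumes "orientation_of H (tower r)" and "traverses H e u v"
  obtains (rim) b i j x where "hub r x" "rim (wheel_size r x) i j"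
      "u = to_nat ((b, i) # x)" "v = to_nat ((b, j) # x)"
  | (out_spoke) b q x where "hub r x" "outward H b x q"
      "u = to_nat x" "v = to_nat ((b, q, 0 :: int) # x)"
  | (in_spoke) b q x where "hub r x" "\<not> outward H b x q"
      "u = to_nat ((b, q, 0 :: int) # x)" "v = to_nat x"
proof -
  from assms have e: "e \<in> edges (tower r)"
    by (auto simp: orientation_of_def traverses_def)
  then obtain y z where yz: "e = to_nat (y, z)" "(y, z) \<in> rim_arcs r \<union> spokes r"
    by auto
  have traverse: "ends H e = Undirected (Upair u v) \<or> ends H e = Directed u v"
    using assms(2) by (simp add: traverses_def)
  have orient: "case ends (tower r) e of Directed u v \<Rightarrow> ends H e = Directed u v
    | Undirected p \<Rightarrow> \<exists>u v. p = Upair u v \<and> ends H e = Directed u v"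
    using assms(1) e unfolding orientation_of_def by blast
  from yz(2) show thesis
  proof
    assume "(y, z) \<in> spokes r"
    then obtain b q x where x: "hub r x" "y = (b, q, 0) # x" "z = x"
      by (auto simp: spokes_def)
    from orient yz(1) \<open>(y, z) \<in> spokes r\<close> traverse
    have dir: "ends H e = Directed u v" and "u = to_nat y \<and> v = to_nat z \<or> u = to_nat z \<and> v = to_nat y"
      by (auto simp: ends_spoke)
    from this(2) show thesis
    proof
      assume "u = to_nat y \<and> v = to_nat z"
      with x dir yz(1) in_spoke[of x b q] show thesis by (auto simp: outward_def)
    next
      assume "u = to_nat z \<and> v = to_nat y"
      with x dir yz(1) out_spoke[of x b q] show thesis by (auto simp: outward_def)
    qed
  next
    assume "(y, z) \<in> rim_arcs r"
    with orient yz(1) traverse have "u = to_nat y" "v = to_nat z"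
      by (auto simp: ends_rim_arc)
    with \<open>(y, z) \<in> rim_arcs r\<close> rim show thesis by (auto simp: rim_arcs_def)
  qed
qed

text \<open>Each condition in \<open>admissible\<close> settles one kind of edge: rim arcs, spokes
  leading back to lower addresses, and spokes leading to higher ones, with the last two roles set by
  \<open>d\<close>.\<close>

lemma orientation_distance_ge:
  assumes "orientation_of H (tower r)" and "admissible r H d g"
    and "pot g w + int n \<le> pot g z"
  shows "enat n \<le> (if d then distance H (to_nat w) (to_nat z) else distance H (to_nat z) (to_nat w))"
proof (cases d)
  case True
  from assms(2) True
  have adm: "\<And>x b i j. hub r x \<Longrightarrow> rim (wheel_size r x) i j \<Longrightarrow> g x (b, j) \<le> g x (b, i) + 1"
    "\<And>x b q. hub r x \<Longrightarrow> 0 \<le> g x (b, q, 0)"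
    "\<And>x b q. hub r x \<Longrightarrow> outward H b x q \<Longrightarrow> g x (b, q, 0) \<le> 1"
    by (auto simp: admissible_def)
  have "pot g (from_nat v) \<le> pot g (from_nat u) + 1" if "traverses H e u v" for e u v
    using assms(1) that
  proof (cases rule: traverses_orientation_cases)
    case (rim b i j x)
    with adm(1)[of x i j b] show ?thesis by simp
  next
    case (out_spoke b q x)
    with adm(3)[of x b q] show ?thesis by simp
  next
    case (in_spoke b q x)
    with adm(2)[of x b q] show ?thesis by simp
  qed
  from distance_ge_if_potential[of H "\<lambda>u. pot g (from_nat u)", OF this] assms(3) True
  show ?thesis by simp
next
  case False
  from assms(2) False
  have adm: "\<And>x b i j. hub r x \<Longrightarrow> rim (wheel_size r x) j i \<Longrightarrow> g x (b, j) \<le> g x (b, i) + 1"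
    "\<And>x b q. hub r x \<Longrightarrow> 0 \<le> g x (b, q, 0)"
    "\<And>x b q. hub r x \<Longrightarrow> \<not> outward H b x q \<Longrightarrow> g x (b, q, 0) \<le> 1"
    by (auto simp: admissible_def)
  \<comment> \<open>With the sign changed, \<open>w\<close> is the high end, so the distance from
    \<open>z\<close> to \<open>w\<close> is bounded.\<close>
  have "- pot g (from_nat v) \<le> - pot g (from_nat u) + 1" if "traverses H e u v" for e u v
    using assms(1) that
  proof (cases rule: traverses_orientation_cases)
    case (rim b i j x)
    with adm(1)[of x i j b] show ?thesis by simp
  next
    case (out_spoke b q x)
    with adm(2)[of x b q] show ?thesis by simp
  next
    case (in_spoke b q x)
    with adm(3)[of x b q] show ?thesis by simp
  qed
  from distance_ge_if_potential[of H "\<lambda>u. - pot g (from_nat u)", OF this] assms(3) False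
  show ?thesis by simp
qed

lemma outward_not_constant:
  assumes "orientation_of H (tower r)" and "strongly_connected H" and "hub r x"
  shows "\<exists>q. outward H b x q = c"
proof (rule ccontr)
  \<comment> \<open>A potential that is constant on the whole wheel is then admissible with arbitrarily large values.\<close>
  assume const: "\<nexists>q. outward H b x q = c"
  let ?z = "(b, 0, 0) # x"
  have "(?z, x) \<in> spokes r"
    using assms(3) by (auto simp: spokes_def)
  with arcs_subset_verts assms(1) have verts: "to_nat x \<in> verts H" "to_nat ?z \<in> verts H"
    by (auto simp: orientation_of_def tower_def)
  define D where "D = (if c then distance H (to_nat x) (to_nat ?z) else distance H (to_nat ?z) (to_nat x))"
  have "\<exists>vs es. path_from_to H (to_nat x) vs es (to_nat ?z)"
    "\<exists>vs es. path_from_to H (to_nat ?z) vs es (to_nat x)"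
    using assms(2) verts unfolding strongly_connected_def by simp_all
  then have "\<exists>n. D \<le> enat n"
    unfolding D_def distance_def by (auto intro: Inf_lower)
  then obtain n where n: "D \<le> enat n" by blast
  let ?g = "\<lambda>y (b', i). if y = x \<and> b' = b then int (Suc n) else 0"
  have "pot ?g y = 0" if "length y \<le> length x" for y
    using that by (induction y) auto
  then have "pot ?g x + int (Suc n) \<le> pot ?g ?z" by simp
  moreover have "admissible r H c ?g"
    using const by (auto simp: admissible_def)
  ultimately have "enat (Suc n) \<le> D"
    unfolding D_def using assms(1) by (intro orientation_distance_ge)
  from order_trans[OF this n] show False by simp
qed

subsection \<open>Connectivity and radius of the tower\<close>

lemma traverses_remove_edge:
  "traverses (remove_edge G e') e u v \<longleftrightarrow> e \<noteq> e' \<and> traverses G e u v"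
  by (auto simp: traverses_def remove_edge_def)

text \<open>All rims survive, and every wheel keeps a spoke, so each wheel stays joined to its hub
  in both directions. Taking an \<open>e\<close> that is no edge gives strong connectivity of the
  tower itself.\<close>

lemma rtrancl_remove_edge_tower:
  assumes "e \<notin> to_nat ` rim_arcs r" and "y \<in> tower_verts r"
  defines "S \<equiv> steps (remove_edge (tower r) e)"
  shows "(to_nat ([] :: vertex), to_nat y) \<in> S\<^sup>* \<and> (to_nat y, to_nat ([] :: vertex)) \<in> S\<^sup>*"
  using assms(2)
proof (induction y)
  case (Cons i x)
  then obtain b q p where i: "i = (b, q, p)" and x: "hub r x" and p: "\<bar>p\<bar> < wheel_size r x"
    by (auto simp: tower_verts_def)
  have step_iff: "(to_nat y, to_nat z) \<in> S \<longleftrightarrow> y \<in> tower_verts r \<and> z \<in> tower_verts r \<and>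
      (\<exists>e'. e' \<noteq> e \<and> traverses (tower r) e' (to_nat y) (to_nat z))" for y z
    by (auto simp: S_def steps_def traverses_remove_edge) (auto simp: remove_edge_def)
  have rim_step: "(to_nat ((b, j) # x), to_nat ((b, k) # x)) \<in> S" if "rim (wheel_size r x) j k" for j k
  proof -
    from that x have arc: "((b, j) # x, (b, k) # x) \<in> rim_arcs r"
      unfolding rim_arcs_def by blast
    with arcs_subset_verts[of r] assms(1) show ?thesis
      unfolding step_iff by (auto simp: traverses_tower)
  qed
  have rim_reach: "(to_nat ((b, j) # x), to_nat ((b, k) # x)) \<in> S\<^sup>*"
    if "(rim (wheel_size r x))\<^sup>*\<^sup>* j k" for j k
    using that by induction (auto intro: rim_step rtrancl_into_rtrancl)
  \<comment> \<open>Paths 0 and 1 have different spokes, so at least one of these is not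
    \<open>e\<close>.\<close>
  obtain q' :: 3 where q': "to_nat ((b, q', 0 :: int) # x, x) \<noteq> e"
  proof (cases "to_nat ((b, 0 :: 3, 0 :: int) # x, x) = e")
    case True
    then have "to_nat ((b, 1 :: 3, 0 :: int) # x, x) \<noteq> e"
      by auto
    with that show thesis by blast
  qed (use that in blast)
  let ?c = "(b, q', 0) # x"
  have spoke: "(?c, x) \<in> spokes r"
    using x by (auto simp: spokes_def)
  with arcs_subset_verts[of r] q' have "(to_nat ?c, to_nat x) \<in> S" "(to_nat x, to_nat ?c) \<in> S"
    unfolding step_iff by (auto simp: traverses_tower)
  moreover have "(to_nat ?c, to_nat (i # x)) \<in> S\<^sup>*" "(to_nat (i # x), to_nat ?c) \<in> S\<^sup>*"
    unfolding i using p by (auto intro!: rim_reach rim_connected)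
  ultimately have "(to_nat x, to_nat (i # x)) \<in> S\<^sup>*" "(to_nat (i # x), to_nat x) \<in> S\<^sup>*"
    by (auto intro: converse_rtrancl_into_rtrancl rtrancl_into_rtrancl)
  with Cons.IH hub_tower_verts[OF x] show ?case
    by (auto intro: rtrancl_trans)
qed simp

lemma strongly_connected_remove_edge_tower:
  assumes "e \<notin> to_nat ` rim_arcs r"
  shows "strongly_connected (remove_edge (tower r) e)"
proof (rule strongly_connected_if_rtrancl)
  fix u v assume "u \<in> verts (remove_edge (tower r) e)" "v \<in> verts (remove_edge (tower r) e)"
  then obtain y z where "u = to_nat y" "v = to_nat z" "y \<in> tower_verts r" "z \<in> tower_verts r"
    by (auto simp: remove_edge_def)
  with rtrancl_remove_edge_tower[OF assms, of y] rtrancl_remove_edge_tower[OF assms, of z]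
  show "(u, v) \<in> (steps (remove_edge (tower r) e))\<^sup>*"
    by (auto intro: rtrancl_trans)
qed

lemma strongly_connected_tower: "strongly_connected (tower r)"
proof -
  have "finite (edges (tower r))"
    using mixed_multigraph_tower by (simp only: mixed_multigraph_def)
  then obtain e where e: "e \<notin> edges (tower r)"
    using ex_new_if_finite infinite_UNIV_nat by blast
  then have "remove_edge (tower r) e = tower r"
    by (simp add: remove_edge_def)
  with strongly_connected_remove_edge_tower[of e r] e show ?thesis by auto
qed

lemma bridgeless_tower: "bridgeless (tower r)"
proof -
  have "strongly_connected (remove_edge (tower r) e)" if "ends (tower r) e = Undirected p" for e p
    using that by (intro strongly_connected_remove_edge_tower) (auto simp: ends_rim_arc)
  then show ?thesis
    by (auto simp: bridgeless_def bridge_def)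
qed

section \<open>Radius of the tower\<close>

lemma relpow_extend:
  assumes "(a, y) \<in> S ^^ n \<and> (y, a) \<in> S ^^ n" and "(y, z) \<in> S" and "(z, y) \<in> S"
  shows "(a, z) \<in> S ^^ Suc n \<and> (z, a) \<in> S ^^ Suc n"
  using assms by (blast intro: relpow_Suc_I relpow_Suc_I2)

lemma relpow_hub:
  assumes "hub r x"
  shows "(to_nat ([] :: vertex), to_nat x) \<in> steps (tower r) ^^ length x \<and>
    (to_nat x, to_nat ([] :: vertex)) \<in> steps (tower r) ^^ length x"
  using assms
proof (induction x)
  case (Cons i x)
  then have x: "hub r x" and arc: "(i # x, x) \<in> spokes r"
    by (auto simp: hub_def spokes_def)
  with arcs_subset_verts[of r]
  have "(to_nat (i # x), to_nat x) \<in> steps (tower r)" "(to_nat x, to_nat (i # x)) \<in> steps (tower r)"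
    by (auto simp: steps_def traverses_tower)
  with relpow_extend[OF Cons.IH[OF x]] show ?case
    by (simp del: relpow.simps)
qed simp

text \<open>One spoke per level and then \<open>k\<close> steps along a two-way path suffice. As
  \<open>k\<close> is below the wheel size, the total is at most \<open>r\<close>.\<close>

lemma relpow_tower:
  assumes "hub r x" and "int k < wheel_size r x" and "p = int k \<or> p = - int k"
  shows "(to_nat ([] :: vertex), to_nat ((b, q, p) # x)) \<in> steps (tower r) ^^ (length x + Suc k) \<and>
    (to_nat ((b, q, p) # x), to_nat ([] :: vertex)) \<in> steps (tower r) ^^ (length x + Suc k)"
  using assms(2,3)
proof (induction k arbitrary: p)
  case 0
  then have arc: "((b, q, p) # x, x) \<in> spokes r"
    using assms(1) by (auto simp: spokes_def)
  with arcs_subset_verts[of r]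
  have "(to_nat ((b, q, p) # x), to_nat x) \<in> steps (tower r)"
    "(to_nat x, to_nat ((b, q, p) # x)) \<in> steps (tower r)"
    by (auto simp: steps_def traverses_tower)
  with relpow_extend[OF relpow_hub[OF assms(1)]] show ?case
    by (simp del: relpow.simps)
next
  case (Suc k)
  \<comment> \<open>The neighbour one step closer to the middle of the path.\<close>
  define p' where "p' = p - sgn p"
  from Suc.prems have p': "p' = int k \<or> p' = - int k" "\<bar>p' - p\<bar> = 1" "\<bar>p - p'\<bar> = 1"
    "\<bar>p\<bar> < wheel_size r x" "\<bar>p'\<bar> < wheel_size r x" "int k < wheel_size r x"
    by (auto simp: p'_def)
  then have "((b, q, p) # x, (b, q, p') # x) \<in> rim_arcs r" "((b, q, p') # x, (b, q, p) # x) \<in> rim_arcs r"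
    using assms(1) by (auto simp: rim_arcs_def rim_def)
  with arcs_subset_verts[of r]
  have "(to_nat ((b, q, p) # x), to_nat ((b, q, p') # x)) \<in> steps (tower r)"
    "(to_nat ((b, q, p') # x), to_nat ((b, q, p) # x)) \<in> steps (tower r)"
    by (auto simp: steps_def traverses_tower)
  with relpow_extend[OF Suc.IH[OF p'(6,1)]] show ?case
    by (simp del: relpow.simps)
qed

lemma eccentricity_root_le: "eccentricity (tower r) (to_nat ([] :: vertex)) \<le> enat r"
proof -
  have root: "([] :: vertex) \<in> tower_verts r"
    by (simp add: tower_verts_def)
  have "distance (tower r) (to_nat ([] :: vertex)) (to_nat y) \<le> enat r \<and>
    distance (tower r) (to_nat y) (to_nat ([] :: vertex)) \<le> enat r" if y: "y \<in> tower_verts r" for y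
  proof -
    have "\<exists>n\<le>r. (to_nat ([] :: vertex), to_nat y) \<in> steps (tower r) ^^ n \<and>
        (to_nat y, to_nat ([] :: vertex)) \<in> steps (tower r) ^^ n"
    proof (cases y)
      case (Cons i x)
      with y obtain b q p where "y = (b, q, p) # x" "hub r x" "\<bar>p\<bar> < wheel_size r x"
        by (auto simp: tower_verts_def)
      with relpow_tower[of r x "nat \<bar>p\<bar>" p b q] show ?thesis
        by (intro exI[of _ "length x + Suc (nat \<bar>p\<bar>)"]) (simp del: relpow.simps, linarith)
    qed auto
    then obtain n where n: "n \<le> r" "(to_nat ([] :: vertex), to_nat y) \<in> steps (tower r) ^^ n"
      "(to_nat y, to_nat ([] :: vertex)) \<in> steps (tower r) ^^ n" by blast
    with distance_le_if_relpow[OF n(2)] distance_le_if_relpow[OF n(3)] root y show ?thesis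
      by (auto intro: order_trans)
  qed
  then show ?thesis
    using finite_tower_verts root by (subst eccentricity_le_iff) auto
qed

text \<open>The last list entry lies on a wheel at the root, so \<open>w\<close> is outside branch
  \<open>c\<close>. Absolute offsets change by at most 1 along the rim and agree at both ends of a
  one-way edge.\<close>

lemma tower_distance_ge:
  fixes w :: vertex
  assumes "w = [] \<or> fst (last w) \<noteq> c" and "0 < r"
  shows "enat r \<le> distance (tower r) (to_nat w) (to_nat [(c, 0 :: 3, int r - 1)])"
proof -
  let ?g = "\<lambda>(x :: vertex) (i :: bool \<times> 3 \<times> int). if fst (last (i # x)) = c then \<bar>snd (snd i)\<bar> + 1 else 0"
  have "pot ?g (from_nat v) \<le> pot ?g (from_nat u) + 1" if "traverses (tower r) e u v" for e u v
    using that unfolding traverses_tower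
    by (auto simp: rim_arcs_def spokes_def rim_def)
  moreover have "pot ?g w = 0"
    using assms(1) by (induction w) (auto split: if_splits)
  ultimately show ?thesis
    using assms(2) by (intro distance_ge_if_potential[where \<phi> = "\<lambda>u. pot ?g (from_nat u)"]) auto
qed

lemma radius_tower:
  assumes "0 < r"
  shows "radius (tower r) = enat r"
proof (rule antisym)
  have root: "([] :: vertex) \<in> tower_verts r"
    by (simp add: tower_verts_def)
  with finite_tower_verts le_radius_iff[of "tower r" "radius (tower r)"]
  have "radius (tower r) \<le> eccentricity (tower r) (to_nat ([] :: vertex))"
    by auto
  also note eccentricity_root_le
  finally show "radius (tower r) \<le> enat r" .
  show "enat r \<le> radius (tower r)"
  proof (subst le_radius_iff; (intro ballI)?)
    fix u assume "u \<in> verts (tower r)"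
    then obtain w where w: "u = to_nat w" "w \<in> tower_verts r" by auto
    \<comment> \<open>A branch at the root that does not contain \<open>w\<close>; at the root
      itself either would do.\<close>
    define c where "c = (w = [] \<or> \<not> fst (last w))"
    have "enat r \<le> distance (tower r) u (to_nat [(c, 0 :: 3, int r - 1)])"
      unfolding w using assms by (intro tower_distance_ge) (auto simp: c_def)
    also have "\<dots> \<le> eccentricity (tower r) u"
      using assms finite_tower_verts
      by (intro distance_le_eccentricity) (auto simp: tower_verts_def hub_def)
    finally show "enat r \<le> eccentricity (tower r) u" .
  qed (use finite_tower_verts root in auto)
qed

subsection \<open>Orientations of the tower\<close>

text \<open>The long potential on the root wheel of branch \<open>c\<close> dictates
  \<open>d\<close>. All higher wheels offer \<open>2 * wheel_size\<close> in either direction, so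
  this \<open>d\<close> can be kept up to the top.\<close>

lemma ex_far_vertex:
  fixes c :: bool
  assumes "orientation_of H (tower r)" and "strongly_connected H" and "0 < r"
  shows "\<exists>d. \<exists>z\<in>tower_verts r. \<forall>w :: vertex. w = [] \<or> fst (last w) \<noteq> c \<longrightarrow>
    enat (r\<^sup>2 + 3 * r - 1) \<le> (if d then distance H (to_nat w) (to_nat z) else distance H (to_nat z) (to_nat w))"
proof -
  have nonconst: "\<exists>a. outward H c x a" "\<exists>a. \<not> outward H c x a" if "hub r x" for x
    using outward_not_constant[OF assms(1,2) that] by blast+
  have size: "1 \<le> wheel_size r x" if "hub r x" for x
    using that by (simp add: hub_def)
  have "hub r []" using assms(3) by (simp add: hub_def)
  from nonconst[OF this] obtain p q where "outward H c [] p" "\<not> outward H c [] q" by blast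
  from ex_long_wheel_potential[OF size[OF \<open>hub r []\<close>], of "outward H c []", OF this]
  obtain d \<gamma>0 where top: "wheel_potential d (int r) (outward H c []) (4 * int r - 1) \<gamma>0"
    by auto
  define n where "n x = (if x = [] then 4 * int r - 1 else 2 * wheel_size r x)" for x :: vertex
  have "\<exists>g. wheel_potential d (wheel_size r x) (outward H c x) (n x) g" if "hub r x" for x
  proof (cases "x = []")
    case True
    with top show ?thesis by (auto simp: n_def)
  next
    case False
    from nonconst[OF that] obtain p q where "outward H c x p" "\<not> outward H c x q" by blast
    from ex_wheel_potential[OF size[OF that], of "outward H c x", OF this] False
    show ?thesis by (simp add: n_def)
  qed
  then obtain \<gamma> where \<gamma>: "\<And>x. hub r x \<Longrightarrow> wheel_potential d (wheel_size r x) (outward H c x) (n x) (\<gamma> x)"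
    by metis
  then have "\<exists>a. n x \<le> \<gamma> x (a, 0)" if "hub r x" for x
    using that by (auto simp: wheel_potential_def)
  then obtain a where a: "\<And>x. hub r x \<Longrightarrow> n x \<le> \<gamma> x (a x, 0)"
    by metis
  \<comment> \<open>Restriction to branch \<open>c\<close> makes \<open>pot g\<close> vanish at
    every \<open>w\<close> outside it.\<close>
  define g :: "vertex \<Rightarrow> bool \<times> 3 \<times> int \<Rightarrow> int"
    where "g = (\<lambda>x (b, i). if b = c \<and> fst (last ((b, i) # x)) = c then \<gamma> x i else 0)"
  have "admissible r H d g"
    unfolding admissible_def
  proof (intro allI impI)
    fix x b assume "hub r x"
    from \<gamma>[OF this]
    show "(\<forall>i j. (if d then rim (wheel_size r x) i j else rim (wheel_size r x) j i) \<longrightarrow>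
           g x (b, j) \<le> g x (b, i) + 1) \<and>
        (\<forall>q. 0 \<le> g x (b, q, 0)) \<and> (\<forall>q. outward H b x q = d \<longrightarrow> g x (b, q, 0) \<le> 1)"
      unfolding wheel_potential_def by (cases "b = c"; cases "x = []") (auto simp: g_def)
  qed
  note dist = orientation_distance_ge[OF assms(1) this]
  \<comment> \<open>The address that moves, on each successive wheel, to a spoke end of large
    potential.\<close>
  define z where "z j = ((\<lambda>x. (c, a x, 0 :: int) # x) ^^ j) []" for j
  have z: "z 0 = []" "z (Suc j) = (c, a (z j), 0) # z j" for j
    by (simp_all add: z_def)
  have len: "length (z j) = j" and zero: "\<forall>(b, q, p)\<in>set (z j). p = 0" for j
    by (induction j) (auto simp: z)
  have hub: "hub r (z j)" if "j < r" for j
    using that zero[of j] by (simp add: hub_def len)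
  have last: "fst (last (z (Suc j))) = c" for j
    by (induction j) (auto simp: z)
  \<comment> \<open>The left side is \<open>4 * r - 1\<close> plus the sum of
    \<open>2 * (r - i)\<close> for \<open>i\<close> from 1 to \<open>j\<close>; at
    \<open>j = r - 1\<close> it equals the claimed bound.\<close>
  have pot: "4 * int r - 1 + 2 * int r * int j - int j * (int j + 1) \<le> pot g (z (Suc j))"
    if "j < r" for j
    using that
  proof (induction j)
    case 0
    with a[OF hub[of 0]] show ?case by (simp add: z g_def n_def)
  next
    case (Suc j)
    from Suc.prems a[OF hub[of "Suc j"]] last[of j]
    have "2 * (int r - int (Suc j)) \<le> g (z (Suc j)) (c, a (z (Suc j)), 0)"
      by (auto simp: z(2)[of j] g_def n_def len)
    moreover have "pot g (z (Suc (Suc j))) = pot g (z (Suc j)) + g (z (Suc j)) (c, a (z (Suc j)), 0)"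
      by (simp add: z(2)[of "Suc j"])
    ultimately show ?case
      using Suc.IH Suc.prems by (simp add: algebra_simps)
  qed
  have "int (r\<^sup>2 + 3 * r - 1) \<le> pot g (z r)"
  proof -
    from assms(3) obtain j where "r = Suc j" by (cases r) auto
    with pot[of j] show ?thesis by (simp add: power2_eq_square algebra_simps)
  qed
  moreover have "pot g w = 0" if "w = [] \<or> fst (last w) \<noteq> c" for w
    using that by (induction w) (auto simp: g_def split: if_splits)
  ultimately have far: "pot g w + int (r\<^sup>2 + 3 * r - 1) \<le> pot g (z r)"
    if "w = [] \<or> fst (last w) \<noteq> c" for w
    using that by simp
  have "z r \<in> tower_verts r"
    using hub[of "r - 1"] z(2)[of "r - 1"] assms(3) by (auto simp: tower_verts_def hub_def len)
  then show ?thesis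
    by (rule bexI[THEN exI[of _ d], rotated]) (intro allI impI dist far)
qed

text \<open>Every vertex misses one of the two branches at the root, and the far vertex of that
  branch bounds its eccentricity.\<close>

lemma radius_orientation_tower:
  assumes "orientation_of H (tower r)" and "strongly_connected H" and "0 < r"
  shows "enat (r\<^sup>2 + 3 * r - 1) \<le> radius H"
proof -
  have verts: "verts H = to_nat ` tower_verts r"
    using assms(1) by (simp add: orientation_of_def)
  have fin: "finite (verts H)" "verts H \<noteq> {}"
    using finite_tower_verts by (auto simp: verts) (auto simp: tower_verts_def)
  show ?thesis
    unfolding le_radius_iff[OF fin]
  proof
    fix u assume "u \<in> verts H"
    then obtain w where w: "u = to_nat w" "w \<in> tower_verts r"
      by (auto simp: verts)
    define c where "c = (w = [] \<or> \<not> fst (last w))"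
    then have "w = [] \<or> fst (last w) \<noteq> c" by auto
    with ex_far_vertex[OF assms, of c] obtain d z where z: "z \<in> tower_verts r"
      "enat (r\<^sup>2 + 3 * r - 1) \<le>
        (if d then distance H (to_nat w) (to_nat z) else distance H (to_nat z) (to_nat w))"
      by blast
    note z(2)
    also have "(if d then distance H (to_nat w) (to_nat z) else distance H (to_nat z) (to_nat w))
        \<le> eccentricity H u"
      using distance_le_eccentricity[OF fin(1)] z(1) w by (simp add: verts)
    finally show "enat (r\<^sup>2 + 3 * r - 1) \<le> eccentricity H u" .
  qed
qed

theorem theorem7:
  fixes r :: nat
  shows "ereal (real r ^ 2 + 3 * real r - 1) \<le> ereal_of_enat (f r)"
  unfolding le_f_iff
proof (intro allI impI notI)
  fix k assume k: "real k < real r ^ 2 + 3 * real r - 1" and bound: "radius_bound r k"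
  \<comment> \<open>For \<open>r = 0\<close> the bound is -1, which no \<open>k\<close>
    undercuts.\<close>
  from k have r: "0 < r" by (cases r) auto
  from bound mixed_multigraph_tower strongly_connected_tower bridgeless_tower radius_tower[OF r]
  obtain H where H: "orientation_of H (tower r)" "strongly_connected H" "radius H \<le> enat k"
    unfolding radius_bound_def by blast
  from radius_orientation_tower[OF H(1,2) r] H(3) have "enat (r\<^sup>2 + 3 * r - 1) \<le> enat k"
    by (rule order_trans)
  then have "r\<^sup>2 + 3 * r \<le> k + 1" by simp
  then have "real (r\<^sup>2 + 3 * r) \<le> real (k + 1)" by (rule of_nat_mono)
  with k show False by simp
qed

end
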